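(* Let $\mathbf{P}\subset\mathbb{C}$ be nonempty and compact. Let $(A,B) \in C_{n,n}(\mathbf{P}) \times C_{n,m}(\mathbf{P})$ be pointwise reachable and suppose that the Hermite indices are constant. Then, for every tuple of continuous functions $\lambda_1, \dots, \lambda_n : \mathbf{P} \to \mathbb{C}$ there is a matrix function $K \in C_{m,n}(\mathbf{P})$ such that $$\sigma ( \mathcal{A}+\mathcal{B}\mathcal{K} ) = \bigcup_{\theta \in \mathbf{P}} \{\lambda_1(\theta),\dots,\lambda_n(\theta)\}.$$
   Context: $C_n(\mathbf{P})$ and $C_{n,m}(\mathbf{P})$ denote the spaces of continuous functions on $\mathbf{P}$ with values in $\mathbb{C}^n$, respectively $\mathbb{C}^{n\times m}$; $C_n(\mathbf{P})$ carries the supremum norm. Here $\mathcal{A}+\mathcal{B}\mathcal{K}$ denotes the bounded multiplication operator on $C_n(\mathbf{P})$ given by $f\mapsto\big(\theta\mapsto (A(\theta)+B(\theta)K(\theta))f(\theta)\big)$, and $\sigma(\cdot)$ is the spectrum of a bounded operator on $C_n(\mathbf{P})$. The pair $(A,B)$ is pointwise reachable if for every $\theta\in\mathbf{P}$ the pair $(A(\theta),B(\theta))\in\mathbb{C}^{n\times n}\times\mathbb{C}^{n\times m}$ is reachable, i.e. $\operatorname{rank}(B(\theta),A(\theta)B(\theta),\dots,A(\theta)^{n-1}B(\theta))=n$. Hermite indices: for a reachable pair $(A,B)\in\mathbb{C}^{n\times n}\times\mathbb{C}^{n\times m}$ with columns $b_1,\dots,b_m$ of $B$, consider the list $b_1,Ab_1,\dots,A^{n-1}b_1,\dots,b_m,Ab_m,\dots,A^{n-1}b_m$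 and select, from left to right, the first linearly independent columns (a vector is selected iff it is not in the span of the vectors preceding it), obtaining $b_1,\dots,A^{h_1-1}b_1,b_2,\dots,A^{h_2-1}b_2,\dots,b_m,\dots,A^{h_m-1}b_m$. The numbers $h_1,\dots,h_m$ are the Hermite indices, with $h_i:=0$ if $b_i$ is not selected. The Hermite indices are constant if those of $(A(\theta),B(\theta))$ do not depend on $\theta\in\mathbf{P}$. *)

theory Defs
  imports "HOL-Analysis.Analysis"
begin

(* The index types 'n and 'm stand for {1..n} and {1..m}; their linear order is the order of
   the rows and columns.  Since nonempty finite types have all sizes >= 1, this means n, m >= 1. *)

(* The space of continuous functions from P to complex^'n.  A function on P is represented by its
   extension by 0 to the whole plane, so that every element has exactly one representative. *)
definition cont_space :: "complex set \<Rightarrow> (complex \<Rightarrow> complex^'n) set" where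
  "cont_space P = {f. continuous_on P f \<and> (\<forall>\<theta>. \<theta> \<notin> P \<longrightarrow> f \<theta> = 0)}"

definition sup_norm :: "complex set \<Rightarrow> (complex \<Rightarrow> complex^'n) \<Rightarrow> real" where
  "sup_norm P f = (SUP \<theta>\<in>P. norm (f \<theta>))"

definition bounded_operator ::
  "complex set \<Rightarrow> ((complex \<Rightarrow> complex^'n) \<Rightarrow> (complex \<Rightarrow> complex^'n)) \<Rightarrow> bool" where
  "bounded_operator P T \<longleftrightarrow>
     (\<forall>f\<in>cont_space P. T f \<in> cont_space P) \<and>
     (\<forall>f\<in>cont_space P. \<forall>g\<in>cont_space P. T (\<lambda>\<theta>. f \<theta> + g \<theta>) = (\<lambda>\<theta>. T f \<theta> + T g \<theta>)) \<and>
     (\<forall>c. \<forall>f\<in>cont_space P. T (\<lambda>\<theta>. c *s f \<theta>) = (\<lambda>\<theta>. c *s T f \<theta>)) \<and>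
     (\<exists>C. \<forall>f\<in>cont_space P. sup_norm P (T f) \<le> C * sup_norm P f)"

(* All z for which z I - T has no two-sided inverse among the bounded operators;
   what T does outside cont_space P is irrelevant. *)
definition op_spectrum ::
  "complex set \<Rightarrow> ((complex \<Rightarrow> complex^'n) \<Rightarrow> (complex \<Rightarrow> complex^'n)) \<Rightarrow> complex set" where
  "op_spectrum P T = {z. \<not> (\<exists>S. bounded_operator P S \<and>
     (\<forall>f\<in>cont_space P. (\<lambda>\<theta>. z *s S f \<theta> - T (S f) \<theta>) = f \<and>
                          S (\<lambda>\<theta>. z *s f \<theta> - T f \<theta>) = f))}"

definition mult_operator ::
  "(complex \<Rightarrow> complex^'n^'n) \<Rightarrow> (complex \<Rightarrow> complex^'n) \<Rightarrow> (complex \<Rightarrow> complex^'n)" where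
  "mult_operator M f = (\<lambda>\<theta>. M \<theta> *v f \<theta>)"

(* A^k b_j, where b_j is column j of B.  (The library power A ^ k would be componentwise.) *)
definition krylov ::
  "complex^'n^'n \<Rightarrow> complex^'m^'n \<Rightarrow> nat \<Rightarrow> 'm \<Rightarrow> complex^'n" where
  "krylov A B k j = (((*v) A) ^^ k) (column j B)"

(* The n x nm matrix (B, AB, ..., A^(n-1) B).  Its columns are indexed by pairs (l, j): here
   card {..<l} runs through 0, ..., n-1 as l runs through 'n, and j is the column within a block. *)
definition reachability_matrix ::
  "complex^'n::{finite,linorder}^'n::{finite,linorder} \<Rightarrow> complex^'m::finite^'n::{finite,linorder} \<Rightarrow> complex^('n::{finite,linorder} \<times> 'm::finite)^'n::{finite,linorder}" where
  "reachability_matrix A B = (\<chi> i p. krylov A B (card {..<fst p}) (snd p) $ i)"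

definition reachable ::
  "complex^'n::{finite,linorder}^'n::{finite,linorder} \<Rightarrow> complex^'m::finite^'n::{finite,linorder} \<Rightarrow> bool" where
  "reachable A B \<longleftrightarrow> rank (reachability_matrix A B) = CARD('n)"

(* A^k b_j is not in the span of its predecessors in the list
   b_1, A b_1, ..., A^(n-1) b_1, ..., b_m, A b_m, ..., A^(n-1) b_m. *)
definition hermite_selected ::
  "complex^'n^'n \<Rightarrow> complex^'m::{finite,linorder}^'n \<Rightarrow> nat \<Rightarrow> 'm \<Rightarrow> bool" where
  "hermite_selected A B k j \<longleftrightarrow>
     krylov A B k j \<notin> vec.span ({krylov A B l i | l i. l < CARD('n) \<and> i < j} \<union>
                                   {krylov A B l j | l. l < k})"

(* The selected vectors A^k b_j form an initial segment k = 0, ..., h_j - 1, so h_j is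
   their number. *)
definition hermite_index ::
  "complex^'n^'n \<Rightarrow> complex^'m::{finite,linorder}^'n \<Rightarrow> 'm \<Rightarrow> nat" where
  "hermite_index A B j = card {k. k < CARD('n) \<and> hermite_selected A B k j}"

end

theory Submission
  imports Defs
begin

text \<open>
  The idea is to apply Ackermann's pole placement formula once for each column of \<open>B\<close>, along a flag of
  invariant subspaces. Fix one parameter and let \<open>U\<^sub>j\<close> be the span of all \<open>A\<^sup>k b\<^sub>i\<close> with \<open>i \<le> j\<close>.
  The \<open>U\<^sub>j\<close> increase, are \<open>A\<close>-invariant, and by reachability exhaust the space; on
  \<open>U\<^sub>j / U\<^sub>j\<^sub>-\<^sub>1\<close> the matrix \<open>A\<close> is cyclic, generated by \<open>b\<^sub>j\<close>, of dimension the Hermite index \<open>h\<^sub>j\<close>.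
  Let \<open>c\<^sub>j\<close> be the coordinate functional of the last selected vector \<open>A\<^bsup>h\<^sub>j-1\<^esup> b\<^sub>j\<close> with respect to the
  basis of all selected vectors, distribute the \<open>n\<close> prescribed eigenvalues over the \<open>n\<close> selected
  vectors, let \<open>p\<^sub>j\<close> be the monic polynomial of degree \<open>h\<^sub>j\<close> whose roots are those given to
  column \<open>j\<close>, and let row \<open>j\<close> of \<open>K\<close> be \<open>- c\<^sub>j p\<^sub>j(A)\<close> (zero if \<open>h\<^sub>j = 0\<close>). Since \<open>c\<^sub>j\<close> vanishes on
  \<open>U\<^sub>j\<^sub>-\<^sub>1\<close>, so does row \<open>j\<close> of \<open>K\<close>. Hence \<open>A + B K\<close> leaves the flag invariant, and on
  \<open>U\<^sub>j / U\<^sub>j\<^sub>-\<^sub>1\<close>, where only row \<open>j\<close> of \<open>K\<close> matters, it acts as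
  \<open>A - b\<^sub>j c\<^sub>j p\<^sub>j(A)\<close>, which has characteristic polynomial \<open>p\<^sub>j\<close>.

  Instead of quotient spaces the proof uses the functionals
  \<open>c\<^sub>j (A - \<mu>\<^sub>1) \<dots> (A - \<mu>\<^sub>d)\<close> with \<open>d < h\<^sub>j\<close>, where the \<open>\<mu>\<^sub>i\<close> are the roots of \<open>p\<^sub>j\<close>. Ordered
  lexicographically by \<open>(j, d)\<close> they are a basis of the dual space in which \<open>A + B K\<close> is triangular
  with the prescribed eigenvalues on the diagonal (\<open>coord_closed_loop\<close>, \<open>det_closed_loop\<close>).

  As the Hermite indices are constant, the same positions are selected for every parameter, so the
  selected vectors form a continuous invertible matrix. By Cramer's rule its inverse is continuous,
  and therefore so are \<open>c\<^sub>j\<close> and \<open>K\<close>. Finally the spectrum of a continuous multiplication operator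
  over a compact parameter set is the union of the pointwise spectra
  (\<open>op_spectrum_mult_operator\<close>), again because the inverse of a continuous invertible matrix
  function is continuous and hence bounded.
\<close>

section \<open>Triangular matrices and independent families\<close>

text \<open>
  The order of the indices is given by an injective rank instead of a type class, so that the same
  matrix indices can be ordered in whichever way makes the matrix triangular. Only the identity
  permutation contributes to the Leibniz formula: a permutation that never decreases the rank
  preserves the sum of the ranks, hence every single rank.
\<close>

lemma det_triangular:
  fixes M :: "'a::comm_ring_1^'n^'n" and rk :: "'n \<Rightarrow> nat"
  assumes "inj rk" and zero: "\<And>i j. rk j < rk i \<Longrightarrow> M $ i $ j = 0"
  shows "det M = (\<Prod>i\<in>UNIV. M $ i $ i)"
proof -
  have vanish: "(\<Prod>i\<in>UNIV. M $ i $ p i) = 0" if p: "p permutes UNIV" and "p \<noteq> id" for p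
  proof (rule ccontr)
    assume nz: "(\<Prod>i\<in>UNIV. M $ i $ p i) \<noteq> 0"
    have le: "rk i \<le> rk (p i)" for i
    proof (rule ccontr)
      assume "\<not> rk i \<le> rk (p i)"
      then have "M $ i $ p i = 0" by (intro zero) simp
      then have "(\<Prod>i\<in>UNIV. M $ i $ p i) = 0" by (intro prod_zero) auto
      with nz show False ..
    qed
    have "sum rk UNIV = sum (rk \<circ> p) UNIV" by (rule sum.permute[OF p])
    then have "rk i = (rk \<circ> p) i" for i
      by (rule sum_mono_inv) (simp_all add: le)
    then have "rk (p i) = rk i" for i by simp
    with \<open>inj rk\<close> have "p = id" by (auto simp: inj_on_def)
    with \<open>p \<noteq> id\<close> show False ..
  qed
  have "det M = (\<Sum>p\<in>{id}. of_int (sign p) * (\<Prod>i\<in>UNIV. M $ i $ p i))"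
    unfolding det_def
    by (rule sum.mono_neutral_right) (auto simp: permutes_id finite_permutations vanish)
  then show ?thesis by (simp add: sign_id)
qed

lemma mat_mult_vector: "mat c *v x = c *s (x :: 'a::comm_semiring_1^'n)"
  by (simp add: mat_def matrix_vector_mult_def vec_eq_iff if_distrib if_distribR cong: if_cong)

lemma matrix_vector_mult_nth: "(M *v x) $ i = (\<Sum>k\<in>UNIV. M $ i $ k * x $ k)"
  by (simp add: matrix_vector_mult_def)

lemma matrix_mult_entry: "(M ** N) $ i $ j = (M *v column j N) $ i"
  by (simp add: matrix_vector_mult_def column_def matrix_matrix_mult_def)

text \<open>
  The rows \<open>w\<^sub>i\<close> of \<open>W\<close> are a basis of the dual space, and the hypothesis says that \<open>w\<^sub>i M - ev\<^sub>i w\<^sub>i\<close>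
  is a combination of rows of higher rank. It is phrased through common kernels because in this
  form it can be checked without computing the combination. On a vector of the dual basis of
  rank at most that of \<open>i\<close> the rows of higher rank vanish, so \<open>W M W\<^sup>-\<^sup>1\<close> is triangular.
\<close>

lemma det_char_of_triangular_rows:
  fixes W M :: "'a::field^'n^'n" and rk :: "'n \<Rightarrow> nat" and ev :: "'n \<Rightarrow> 'a"
  assumes "invertible W" and "inj rk"
    and tri: "\<And>i x. (\<And>j. rk i < rk j \<Longrightarrow> (W *v x) $ j = 0) \<Longrightarrow>
                (W *v (M *v x)) $ i = ev i * (W *v x) $ i"
  shows "det (mat z - M) = (\<Prod>i\<in>UNIV. z - ev i)"
proof -
  obtain V where V: "W ** V = mat 1" "V ** W = mat 1"
    using \<open>invertible W\<close> by (auto simp: invertible_def)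
  have dual: "(W *v column j V) $ i = (if i = j then 1 else 0)" for i j
  proof -
    have "(W *v column j V) $ i = (W ** V) $ i $ j" by (simp add: matrix_mult_entry)
    then show ?thesis by (simp add: V mat_def)
  qed
  define L where "L = W ** (mat z - M) ** V"
  have L: "L $ i $ j = (z - ev i) * (if i = j then 1 else 0)" if "rk j \<le> rk i" for i j
  proof -
    have "L $ i $ j = (W *v ((mat z - M) *v column j V)) $ i"
      by (simp add: L_def matrix_mult_entry matrix_vector_mul_assoc)
    also have "\<dots> = z * (W *v column j V) $ i - (W *v (M *v column j V)) $ i"
      by (simp add: matrix_vector_mult_diff_rdistrib mat_mult_vector vec.diff vec.scale)
    also have "(W *v (M *v column j V)) $ i = ev i * (W *v column j V) $ i"
      using that by (intro tri) (auto simp: dual)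
    finally show ?thesis by (simp add: dual algebra_simps)
  qed
  have "det L = (\<Prod>i\<in>UNIV. L $ i $ i)"
    using \<open>inj rk\<close> by (rule det_triangular) (auto simp: L)
  also have "\<dots> = (\<Prod>i\<in>UNIV. z - ev i)" by (simp add: L)
  finally have "det L = (\<Prod>i\<in>UNIV. z - ev i)" .
  moreover have "det L = det (mat z - M) * det (W ** V)"
    by (simp add: L_def det_mul)
  ultimately show ?thesis by (simp add: V)
qed

lemma independent_if_ranked:
  fixes f :: "'b \<Rightarrow> 'a::field^'n" and rk :: "'b \<Rightarrow> nat"
  assumes "finite I" and "inj_on rk I"
    and "\<And>p. p \<in> I \<Longrightarrow> f p \<notin> vec.span (f ` {q\<in>I. rk q < rk p})"
  shows "vec.independent (f ` I) \<and> inj_on f I"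
  using assms
proof (induction "card I" arbitrary: I)
  case 0
  then show ?case by (simp add: vec.independent_empty)
next
  case (Suc c)
  then have "rk ` I \<noteq> {}" by auto
  with Suc.prems have "Max (rk ` I) \<in> rk ` I" by (intro Max_in) auto
  then obtain p where p: "p \<in> I" "rk p = Max (rk ` I)" by auto
  define J where "J = I - {p}"
  \<comment> \<open>Remove the element of highest rank, which is new with respect to all others.\<close>
  have lower: "{q\<in>I. rk q < rk p} = J"
  proof -
    have "rk q < rk p" if "q \<in> J" for q
    proof -
      have "rk q \<le> rk p" using that p Suc.prems by (auto simp: J_def)
      moreover have "rk q \<noteq> rk p"
        using that p Suc.prems(2) by (auto simp: J_def inj_on_def)
      ultimately show ?thesis by simp
    qed
    then show ?thesis by (auto simp: J_def)
  qed
  have I: "I = insert p J" "p \<notin> J" using p by (auto simp: J_def)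
  have "vec.independent (f ` J) \<and> inj_on f J"
  proof (rule Suc.hyps(1))
    show "c = card J" using Suc I by simp
    show "f q \<notin> vec.span (f ` {r \<in> J. rk r < rk q})" if "q \<in> J" for q
      using Suc.prems(3)[of q] that vec.span_mono[of "f ` {r \<in> J. rk r < rk q}" "f ` {r \<in> I. rk r < rk q}"]
      by (auto simp: I)
  qed (use Suc.prems in \<open>auto simp: I\<close>)
  moreover have "f p \<notin> vec.span (f ` J)" using Suc.prems(3)[OF p(1)] by (simp add: lower)
  ultimately show ?case
    using vec.span_base[of "f p" "f ` J"] by (auto simp: I vec.independent_insertI)
qed

text \<open>
  The rank is the dimension of the row space, so full rank makes the rows independent; a matrix
  with independent rows has a right inverse and is therefore surjective.
\<close>

lemma span_columns_if_full_rank: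
  fixes M :: "'a::field^'m^'n"
  assumes "rank M = CARD('n)"
  shows "vec.span (columns M) = UNIV"
proof -
  have rows: "rows M = (\<lambda>i. row i M) ` UNIV" by (auto simp: rows_def)
  have dim: "vec.dim (rows M) = CARD('n)" using assms by (simp add: row_rank_def_gen)
  have le: "card (rows M) \<le> CARD('n)" unfolding rows by (rule card_image_le) simp
  have ind: "vec.independent (rows M)"
    by (rule vec.card_le_dim_spanning[where V="rows M"])
      (use le dim in \<open>auto simp: rows vec.span_base\<close>)
  then have "card (rows M) = CARD('n)" using dim vec.dim_eq_card_independent by metis
  then have inj: "inj (\<lambda>i. row i M)"
    unfolding rows by (intro eq_card_imp_inj_on) auto
  have "\<forall>i. c i = 0" if "(\<Sum>i\<in>UNIV. c i *s row i M) = 0" for c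
  proof -
    define g where "g = c \<circ> inv (\<lambda>i. row i M)"
    have "(\<Sum>v\<in>rows M. g v *s v) = (\<Sum>i\<in>UNIV. c i *s row i M)"
      unfolding rows by (subst sum.reindex[OF inj]) (simp add: g_def o_def inv_f_f[OF inj])
    then have "g v = 0" if "v \<in> rows M" for v
      using vec.independentD[OF ind, of "rows M" g v] that \<open>_ = 0\<close> by (simp add: rows)
    then show ?thesis by (force simp: g_def rows inv_f_f[OF inj])
  qed
  then have "\<exists>N. M ** N = mat 1" using matrix_right_invertible_independent_rows by blast
  then show ?thesis using matrix_right_invertible_span_columns by blast
qed

section \<open>Continuous matrix functions\<close>

lemma continuous_on_det:
  fixes M :: "'b::topological_space \<Rightarrow> 'a::real_normed_field^'n^'n"
  assumes "continuous_on P M"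
  shows "continuous_on P (\<lambda>t. det (M t))"
  unfolding det_def
  by (intro continuous_on_sum continuous_on_mult continuous_on_const continuous_on_prod
      continuous_on_component assms)

lemma continuous_on_matrix_mult:
  fixes M :: "'b::topological_space \<Rightarrow> 'a::real_normed_field^'k^'n"
  assumes "continuous_on P M" "continuous_on P N"
  shows "continuous_on P (\<lambda>t. M t ** (N t :: 'a^'l^'k))"
  unfolding matrix_matrix_mult_def
  by (intro continuous_on_vec_lambda continuous_on_sum continuous_on_mult continuous_on_component assms)

lemma continuous_on_matrix_vector_mult:
  fixes M :: "'b::topological_space \<Rightarrow> 'a::real_normed_field^'k^'n"
  assumes "continuous_on P M" "continuous_on P f"
  shows "continuous_on P (\<lambda>t. M t *v f t)"
  unfolding matrix_vector_mult_def
  by (intro continuous_on_vec_lambda continuous_on_sum continuous_on_mult continuous_on_component assms)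

text \<open>
  By Cramer's rule the entries of the inverse are quotients of determinants.
\<close>

lemma continuous_inverse_matrix:
  fixes M :: "'b::topological_space \<Rightarrow> 'a::real_normed_field^'n^'n"
  assumes M: "continuous_on P M" and inv: "\<And>t. t \<in> P \<Longrightarrow> invertible (M t)"
  shows "\<exists>N. continuous_on P N \<and> (\<forall>t\<in>P. M t ** N t = mat 1 \<and> N t ** M t = mat 1)"
proof -
  define N :: "'b \<Rightarrow> 'a^'n^'n" where
    "N t = (\<chi> k l. det (\<chi> i j. if j = k then axis l 1 $ i else M t $ i $ j) / det (M t))" for t
  have right: "M t ** N t = mat 1" if "t \<in> P" for t
  proof -
    have d: "det (M t) \<noteq> 0" using inv[OF that] by (simp add: invertible_det_nz)
    have "M t *v (\<chi> k. N t $ k $ l) = axis l 1" for l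
      using cramer[OF d, of "\<chi> k. N t $ k $ l" "axis l 1"] by (simp add: N_def)
    then show ?thesis
      by (simp add: vec_eq_iff matrix_matrix_mult_def matrix_vector_mult_def mat_def axis_def)
  qed
  have "continuous_on P (\<lambda>t. if j = k then axis l 1 $ i else M t $ i $ j)" for i j k l
    by (cases "j = k") (simp_all add: continuous_on_component M)
  then have "continuous_on P N"
    unfolding N_def using inv
    by (intro continuous_on_vec_lambda continuous_on_divide continuous_on_det M)
      (auto simp: invertible_det_nz)
  moreover have "N t ** M t = mat 1" if "t \<in> P" for t
    using right[OF that] by (simp add: matrix_left_right_inverse[of "N t"])
  ultimately show ?thesis using right by blast
qed

section \<open>Krylov flags and Hermite indices\<close>

lemma krylov_0: "krylov A B 0 j = column j B"
  and krylov_Suc: "krylov A B (Suc k) j = A *v krylov A B k j"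
  by (simp_all add: krylov_def)

lemma mult_span_subset:
  fixes M :: "'a::field^'n^'m"
  assumes "x \<in> vec.span S" and "\<And>s. s \<in> S \<Longrightarrow> M *v s \<in> T" and "vec.subspace T"
  shows "M *v x \<in> T"
proof -
  have "M *v x \<in> vec.span ((*v) M ` S)"
    using assms(1) by (auto simp: vec.span_image)
  also have "\<dots> \<subseteq> T" using assms(2,3) by (intro vec.span_minimal) auto
  finally show ?thesis .
qed

text \<open>
  A weak form of the Cayley-Hamilton theorem: among the \<open>n + 1\<close> vectors \<open>b, A b, \<dots>, A\<^sup>n b\<close> some
  \<open>A\<^sup>k b\<close> lies in the span of its predecessors, and that span is then \<open>A\<close>-invariant. It lets the
  bound on the exponent be dropped in the definition of the Hermite indices.
\<close>

lemma krylov_in_span_initial: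
  fixes A :: "complex^'n^'n" and B :: "complex^'m^'n"
  shows "krylov A B m j \<in> vec.span {krylov A B l j | l. l < CARD('n)}"
proof -
  have "\<exists>k\<le>CARD('n). krylov A B k j \<in> vec.span ((\<lambda>l. krylov A B l j) ` {..<k})"
  proof (rule ccontr)
    assume "\<not> ?thesis"
    then have new: "krylov A B k j \<notin> vec.span ((\<lambda>l. krylov A B l j) ` {..<k})" if "k \<le> CARD('n)" for k
      using that by blast
    have "vec.independent ((\<lambda>l. krylov A B l j) ` {..CARD('n)}) \<and>
          inj_on (\<lambda>l. krylov A B l j) {..CARD('n)}"
    proof (rule independent_if_ranked[where rk = id])
      fix k assume "k \<in> {..CARD('n)}"
      moreover from this have "{l \<in> {..CARD('n)}. id l < id k} = {..<k}" by auto
      ultimately show "krylov A B k j \<notin>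
          vec.span ((\<lambda>l. krylov A B l j) ` {l \<in> {..CARD('n)}. id l < id k})"
        using new by simp
    qed auto
    then have "CARD('n) + 1 \<le> vec.dim (UNIV :: (complex^'n) set)"
      using vec.independent_card_le_dim[of "(\<lambda>l. krylov A B l j) ` {..CARD('n)}" UNIV]
      by (simp add: card_image del: vec.dim_UNIV)
    then show False by (simp only: vec_dim_card)
  qed
  then obtain k where k: "k \<le> CARD('n)"
    and dep: "krylov A B k j \<in> vec.span ((\<lambda>l. krylov A B l j) ` {..<k})" (is "_ \<in> ?V") by blast
  have "krylov A B m j \<in> ?V"
  proof (induction m)
    case 0
    show ?case using dep by (cases k) (auto intro!: vec.span_base)
  next
    case (Suc m)
    have "A *v krylov A B m j \<in> ?V"
      using Suc
    proof (rule mult_span_subset)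
      fix s assume "s \<in> (\<lambda>l. krylov A B l j) ` {..<k}"
      then obtain l where l: "l < k" "s = krylov A B l j" by auto
      show "A *v s \<in> ?V"
        using l dep by (cases "Suc l = k") (auto simp flip: krylov_Suc intro!: vec.span_base)
    qed (rule vec.subspace_span)
    then show ?case by (simp add: krylov_Suc)
  qed
  also have "?V \<subseteq> vec.span {krylov A B l j | l. l < CARD('n)}"
    using k by (intro vec.span_mono) auto
  finally show ?thesis .
qed

text \<open>
  The span of the predecessors of \<open>A\<^sup>k b\<^sub>j\<close> in the list of Krylov vectors with all powers of \<open>A\<close>.
  Without a bound on the exponents the invariance properties \<open>mult_flag\<close> and \<open>mult_flag_0\<close> are immediate.
\<close>

definition flag :: "complex^'n^'n \<Rightarrow> complex^'m::{finite,linorder}^'n \<Rightarrow> 'm \<Rightarrow> nat \<Rightarrow> (complex^'n) set" where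
  "flag A B j k = vec.span ({krylov A B l i | l i. i < j} \<union> {krylov A B l j | l. l < k})"

lemma subspace_flag: "vec.subspace (flag A B j k)"
  by (simp add: flag_def vec.subspace_span)

lemma krylov_in_flag: "i < j \<or> i = j \<and> l < k \<Longrightarrow> krylov A B l i \<in> flag A B j k"
  unfolding flag_def by (rule vec.span_base) auto

lemma flag_mono: "i < j \<or> i = j \<and> l \<le> k \<Longrightarrow> flag A B i l \<subseteq> flag A B j k"
proof -
  assume "i < j \<or> i = j \<and> l \<le> k"
  then have "i' < j \<or> i' = j \<and> l' < k" if "i' < i \<or> i' = i \<and> l' < l" for i' l'
    using that by (auto dest: less_trans)
  then show ?thesis
    unfolding flag_def[of A B i l]
    by (intro vec.span_minimal subspace_flag) (blast intro: krylov_in_flag)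
qed

lemma flag_SucE:
  assumes "x \<in> flag A B j (Suc k)"
  obtains a where "x - a *s krylov A B k j \<in> flag A B j k"
proof -
  have "{krylov A B l i | l i. i < j} \<union> {krylov A B l j | l. l < Suc k} =
    insert (krylov A B k j) ({krylov A B l i | l i. i < j} \<union> {krylov A B l j | l. l < k})"
    by (auto simp: less_Suc_eq)
  then have "\<exists>a. x - a *s krylov A B k j \<in> flag A B j k"
    using assms by (simp only: flag_def vec.span_breakdown_eq)
  with that show ?thesis by blast
qed

lemma mult_flag:
  assumes "x \<in> flag A B j k"
  shows "A *v x \<in> flag A B j (Suc k)"
  using assms unfolding flag_def[of A B j k]
proof (rule mult_span_subset)
  fix s assume "s \<in> {krylov A B l i | l i. i < j} \<union> {krylov A B l j | l. l < k}"
  then obtain l i where "s = krylov A B l i" "i < j \<or> i = j \<and> l < k" by blast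
  then show "A *v s \<in> flag A B j (Suc k)"
    by (simp add: krylov_in_flag flip: krylov_Suc)
qed (rule subspace_flag)

lemma mult_flag_0:
  assumes "x \<in> flag A B j 0"
  shows "A *v x \<in> flag A B j 0"
  using assms unfolding flag_def[of A B j 0]
proof (rule mult_span_subset)
  fix s assume "s \<in> {krylov A B l i | l i. i < j} \<union> {krylov A B l j | l. l < 0}"
  then obtain l i where "s = krylov A B l i" "i < j" by blast
  then show "A *v s \<in> vec.span ({krylov A B l i | l i. i < j} \<union> {krylov A B l j | l. l < 0})"
    using krylov_in_flag[of i j "Suc l" 0 A B] by (simp add: flag_def krylov_Suc)
qed (rule vec.subspace_span)

lemma hermite_selected_iff:
  fixes A :: "complex^'n^'n" and B :: "complex^'m::{finite,linorder}^'n"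
  shows "hermite_selected A B k j \<longleftrightarrow> krylov A B k j \<notin> flag A B j k"
proof -
  let ?S = "{krylov A B l i | l i. l < CARD('n) \<and> i < j} \<union> {krylov A B l j | l. l < k}"
  have "krylov A B l i \<in> vec.span ?S" if "i < j" for l i
    using krylov_in_span_initial[of A B l i] that
      vec.span_mono[of "{krylov A B l i | l. l < CARD('n)}" ?S] by blast
  then have "flag A B j k \<subseteq> vec.span ?S"
    unfolding flag_def by (intro vec.span_minimal vec.subspace_span) (auto intro: vec.span_base)
  moreover have "vec.span ?S \<subseteq> flag A B j k"
    unfolding flag_def by (rule vec.span_mono) auto
  ultimately show ?thesis unfolding hermite_selected_def by blast
qed

lemma down_closed_eq_lessThan_card:
  fixes D :: "nat set"
  assumes "finite D" and "\<And>k. Suc k \<in> D \<Longrightarrow> k \<in> D"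
  shows "D = {..<card D}"
proof -
  obtain m where m: "m \<notin> D" "\<And>k. k < m \<Longrightarrow> k \<in> D"
    using ex_new_if_finite[OF infinite_UNIV_nat assms(1)] exists_least_iff[of "\<lambda>k. k \<notin> D"] by blast
  have "k \<notin> D" if "m \<le> k" for k
    using that by (induction k rule: dec_induct) (use m assms(2) in auto)
  with m have "D = {..<m}" by (force simp: not_le[symmetric])
  then show ?thesis by simp
qed

text \<open>
  If \<open>A\<^sup>k b\<^sub>j\<close> is not selected, applying \<open>A\<close> shows that \<open>A\<^bsup>k+1\<^esup> b\<^sub>j\<close> is not selected either. The
  selected exponents of a column therefore form an initial segment, and its length is the Hermite
  index.
\<close>

lemma krylov_in_flag_iff_hermite_index:
  fixes A :: "complex^'n^'n" and B :: "complex^'m::{finite,linorder}^'n"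
  shows "krylov A B k j \<in> flag A B j k \<longleftrightarrow> hermite_index A B j \<le> k"
proof -
  define D where "D = {k. krylov A B k j \<notin> flag A B j k}"
  have small: "k < CARD('n)" if "k \<in> D" for k
  proof (rule ccontr)
    assume "\<not> k < CARD('n)"
    then have "vec.span {krylov A B l j | l. l < CARD('n)} \<subseteq> flag A B j k"
      unfolding flag_def by (intro vec.span_mono) auto
    with krylov_in_span_initial[of A B k j] that show False by (auto simp: D_def)
  qed
  have "finite D" by (rule finite_subset[of _ "{..<CARD('n)}"]) (auto dest: small)
  then have "D = {..<card D}"
    by (rule down_closed_eq_lessThan_card) (auto simp: D_def krylov_Suc dest: mult_flag)
  moreover have "card D = hermite_index A B j"
  proof -
    have "D = {k. k < CARD('n) \<and> hermite_selected A B k j}"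
      using small unfolding D_def hermite_selected_iff by blast
    then show ?thesis by (simp add: hermite_index_def)
  qed
  ultimately have "k \<in> D \<longleftrightarrow> k < hermite_index A B j" by (metis lessThan_iff)
  then show ?thesis by (auto simp: D_def)
qed

lemma hermite_index_le: "hermite_index A B j \<le> CARD('n)"
  for A :: "complex^'n^'n" and B :: "complex^'m::{finite,linorder}^'n"
proof -
  have "card {k. k < CARD('n) \<and> hermite_selected A B k j} \<le> card {..<CARD('n)}"
    by (rule card_mono) auto
  then show ?thesis by (simp add: hermite_index_def)
qed

definition hermite_positions :: "complex^'n^'n \<Rightarrow> complex^'m::{finite,linorder}^'n \<Rightarrow> ('m \<times> nat) set" where
  "hermite_positions A B = Sigma UNIV (\<lambda>j. {..<hermite_index A B j})"

text \<open>
  A discarded vector lies in the span of its predecessors, so by induction along the list every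
  vector lies in the span of the selected vectors up to its own position.
\<close>

lemma flag_subset_span_selected:
  fixes A :: "complex^'n^'n" and B :: "complex^'m::{finite,linorder}^'n"
  shows "flag A B j k \<subseteq> vec.span ((\<lambda>(i, l). krylov A B l i) `
           {(i, l) \<in> hermite_positions A B. i < j \<or> i = j \<and> l < k})"
    (is "_ \<subseteq> vec.span (?w ` ?S j k)")
proof (induction "card {..<j}" arbitrary: j k rule: less_induct)
  case less
  have IH: "flag A B i l \<subseteq> vec.span (?w ` ?S i l)" if "i < j" for i l
    using that by (intro less psubset_card_mono) (auto simp: psubset_eq dest: less_trans)
  have mono: "vec.span (?w ` ?S i l) \<subseteq> vec.span (?w ` ?S j k)"
    if "i < j \<or> i = j \<and> l \<le> k" for i l k
    using that by (intro vec.span_mono image_mono) (auto dest: less_trans)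
  show ?case
  proof (induction k)
    case 0
    have "krylov A B l i \<in> vec.span (?w ` ?S j 0)" if "i < j" for l i
      using IH[OF that, of "Suc l"] mono[of i "Suc l" 0] that krylov_in_flag[of i i l "Suc l" A B]
      by blast
    then show ?case
      unfolding flag_def[of A B j 0] by (intro vec.span_minimal vec.subspace_span) auto
  next
    case (Suc k)
    have below: "flag A B j k \<subseteq> vec.span (?w ` ?S j (Suc k))"
      using Suc mono[of j k "Suc k"] by auto
    have top: "krylov A B k j \<in> vec.span (?w ` ?S j (Suc k))"
    proof (cases "k < hermite_index A B j")
      case True
      then have "(j, k) \<in> ?S j (Suc k)" by (simp add: hermite_positions_def)
      then show ?thesis by (intro vec.span_base) (auto intro!: image_eqI)
    next
      case False
      then show ?thesis using below krylov_in_flag_iff_hermite_index[of A B k j] by auto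
    qed
    show ?case
    proof
      fix x assume "x \<in> flag A B j (Suc k)"
      then obtain a where "x - a *s krylov A B k j \<in> flag A B j k" by (rule flag_SucE)
      then have "(x - a *s krylov A B k j) + a *s krylov A B k j \<in> vec.span (?w ` ?S j (Suc k))"
        using below top by (intro vec.span_add vec.span_scale) auto
      then show "x \<in> vec.span (?w ` ?S j (Suc k))" by simp
    qed
  qed
qed

text \<open>
  A numerical code for the lexicographic order on pairs \<open>(j, k)\<close> with \<open>k < n\<close>.
\<close>

definition lex_pos :: "nat \<Rightarrow> 'm::{finite,linorder} \<times> nat \<Rightarrow> nat" where
  "lex_pos n p = card {..<fst p} * n + snd p"

lemma lex_pos_less:
  fixes i j :: "'m::{finite,linorder}"
  assumes "k < n"
  shows "i < j \<or> i = j \<and> k < l \<Longrightarrow> lex_pos n (i, k) < lex_pos n (j, l)"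
proof -
  assume *: "i < j \<or> i = j \<and> k < l"
  show ?thesis
  proof (cases "i < j")
    case True
    then have "card {..<i} < card {..<j}"
      by (intro psubset_card_mono) (auto simp: psubset_eq dest: less_trans)
    then have "(card {..<i} + 1) * n \<le> card {..<j} * n" by (intro mult_right_mono) auto
    with \<open>k < n\<close> show ?thesis by (simp add: lex_pos_def)
  next
    case False
    with * show ?thesis by (simp add: lex_pos_def)
  qed
qed

lemma lex_pos_less_iff:
  fixes i j :: "'m::{finite,linorder}"
  assumes "k < n" "l < n"
  shows "lex_pos n (i, k) < lex_pos n (j, l) \<longleftrightarrow> i < j \<or> i = j \<and> k < l"
  using lex_pos_less[of k n i j l] lex_pos_less[of l n j i k] assms
  by (metis less_asym less_irrefl linorder_neqE)

lemma inj_on_lex_pos: "inj_on (lex_pos n) {(j :: 'm::{finite,linorder}, k). k < n}"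
proof (rule inj_onI, clarify)
  fix i j :: 'm and k l :: nat assume "k < n" "l < n" "lex_pos n (i, k) = lex_pos n (j, l)"
  then show "i = j \<and> k = l"
    using lex_pos_less_iff[of k n l i j] lex_pos_less_iff[of l n k j i]
    by (metis less_irrefl linorder_neqE)
qed

text \<open>
  Selected vectors are new with respect to their predecessors, hence independent; they span every
  column of the reachability matrix. So for a reachable pair they are a basis.
\<close>

lemma hermite_basis:
  fixes A :: "complex^'n::{finite,linorder}^'n::{finite,linorder}" and B :: "complex^'m::{finite,linorder}^'n::{finite,linorder}"
  assumes "reachable A B"
  shows "card (hermite_positions A B) = CARD('n)"
    and "vec.span ((\<lambda>(i, l). krylov A B l i) ` hermite_positions A B) = UNIV"
proof -
  let ?w = "\<lambda>(i, l). krylov A B l i" and ?S = "hermite_positions A B"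
  have small: "l < CARD('n)" if "(i, l) \<in> ?S" for i l
    using that hermite_index_le[of A B i] by (auto simp: hermite_positions_def)
  have fin: "finite ?S" by (simp add: hermite_positions_def)
  have "vec.independent (?w ` ?S) \<and> inj_on ?w ?S"
  proof (rule independent_if_ranked[where rk = "lex_pos CARD('n)"])
    show "inj_on (lex_pos CARD('n)) ?S"
      by (rule inj_on_subset[OF inj_on_lex_pos]) (auto dest: small)
    fix p assume p: "p \<in> ?S"
    obtain j k where jk: "p = (j, k)" by force
    have "vec.span (?w ` {q \<in> ?S. lex_pos CARD('n) q < lex_pos CARD('n) p}) \<subseteq> flag A B j k"
      using p by (intro vec.span_minimal subspace_flag)
        (auto simp: jk lex_pos_less_iff small intro!: krylov_in_flag)
    moreover have "krylov A B k j \<notin> flag A B j k"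
      using p krylov_in_flag_iff_hermite_index[of A B k j] by (simp add: jk hermite_positions_def)
    ultimately show "?w p \<notin> vec.span (?w ` {q \<in> ?S. lex_pos CARD('n) q < lex_pos CARD('n) p})"
      by (auto simp: jk)
  qed (rule fin)
  moreover show span: "vec.span (?w ` ?S) = UNIV"
  proof -
    have "krylov A B l i \<in> vec.span (?w ` ?S)" for l i
      using flag_subset_span_selected[of A B i "Suc l"] krylov_in_flag[of i i l "Suc l" A B]
        vec.span_mono[of "?w ` {(i', l') \<in> ?S. i' < i \<or> i' = i \<and> l' < Suc l}" "?w ` ?S"] by blast
    then have "columns (reachability_matrix A B) \<subseteq> vec.span (?w ` ?S)"
      by (auto simp: columns_def column_def reachability_matrix_def)
    then have "vec.span (columns (reachability_matrix A B)) \<subseteq> vec.span (?w ` ?S)"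
      by (intro vec.span_minimal vec.subspace_span)
    moreover have "vec.span (columns (reachability_matrix A B)) = UNIV"
      using assms by (intro span_columns_if_full_rank) (simp add: reachable_def)
    ultimately show ?thesis by auto
  qed
  ultimately have "card (?w ` ?S) = vec.dim (UNIV :: (complex^'n::{finite,linorder}) set)"
    by (intro vec.basis_card_eq_dim) auto
  with \<open>_ \<and> inj_on ?w ?S\<close> show "card ?S = CARD('n)"
    by (simp add: card_image vec_dim_card del: vec.dim_UNIV)
qed

section \<open>Pole placement at a single parameter\<close>

text \<open>
  The matrix \<open>p(A)\<close> for the monic polynomial \<open>p\<close> with roots \<open>\<mu> 0, \<dots>, \<mu> (d - 1)\<close>.
\<close>

primrec shift_prod :: "complex^'n^'n \<Rightarrow> (nat \<Rightarrow> complex) \<Rightarrow> nat \<Rightarrow> complex^'n^'n" where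
  "shift_prod A \<mu> 0 = mat 1"
| "shift_prod A \<mu> (Suc d) = shift_prod A \<mu> d ** (A - mat (\<mu> d))"

text \<open>
  The bijection \<open>\<phi>\<close> numbers the selected positions \<open>(j, k)\<close>, and \<open>V\<close> is the inverse of the matrix of
  selected vectors, so that row \<open>inv \<phi> (j, h j - 1)\<close> of \<open>V\<close> is the functional \<open>c\<^sub>j\<close>. Row \<open>j\<close> of the
  feedback is Ackermann's formula \<open>- c\<^sub>j p\<^sub>j(A)\<close>. A column without selected vector has no functional
  \<open>c\<^sub>j\<close> and gets no feedback.
\<close>

definition ackermann_feedback ::
  "('m \<Rightarrow> nat) \<Rightarrow> ('n \<Rightarrow> 'm \<times> nat) \<Rightarrow> ('n \<Rightarrow> complex) \<Rightarrow> complex^'n^'n \<Rightarrow> complex^'n^'n \<Rightarrow> complex^'n^'m" where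
  "ackermann_feedback h \<phi> ev V A = (\<chi> j. if h j = 0 then 0
     else - (V ** shift_prod A (\<lambda>d. ev (inv \<phi> (j, d))) (h j)) $ inv \<phi> (j, h j - 1))"

locale hermite_coordinates =
  fixes A :: "complex^'n^'n"
    and B :: "complex^'m::{finite,linorder}^'n"
    and \<phi> :: "'n \<Rightarrow> 'm \<times> nat" and V :: "complex^'n^'n" and ev :: "'n \<Rightarrow> complex"
  assumes bij: "bij_betw \<phi> UNIV (hermite_positions A B)"
    and V_basis: "\<And>q. V *v krylov A B (snd (\<phi> q)) (fst (\<phi> q)) = axis q 1"
begin

abbreviation h :: "'m \<Rightarrow> nat" where "h \<equiv> hermite_index A B"
abbreviation slot :: "'m \<Rightarrow> nat \<Rightarrow> 'n" where "slot j k \<equiv> inv \<phi> (j, k)"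

text \<open>
  The functional \<open>c\<^sub>j (A - \<mu>\<^sub>0) \<dots> (A - \<mu>\<^bsub>d-1\<^esub>)\<close>, where \<open>\<mu>\<^sub>k\<close> is the eigenvalue assigned to the
  position \<open>(j, k)\<close>. For \<open>d = h j > 0\<close> it is the negative of row \<open>j\<close> of the feedback.
\<close>

definition coord :: "'m \<Rightarrow> nat \<Rightarrow> complex^'n \<Rightarrow> complex" where
  "coord j d x = (V *v (shift_prod A (\<lambda>d. ev (slot j d)) d *v x)) $ slot j (h j - 1)"

lemma inj_phi: "inj \<phi>" using bij by (simp add: bij_betw_def)

lemma phi_slot: "k < h j \<Longrightarrow> \<phi> (slot j k) = (j, k)"
  using bij by (intro f_inv_into_f) (auto simp: bij_betw_def hermite_positions_def)

lemma phi_less: "\<phi> q = (j, k) \<Longrightarrow> k < h j"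
  using bij rangeI[of \<phi> q] by (auto simp: bij_betw_def hermite_positions_def)

lemma slot_eq: "\<phi> q = (j, k) \<Longrightarrow> slot j k = q"
  using inv_f_f[OF inj_phi, of q] by simp

lemma V_krylov: "k < h j \<Longrightarrow> V *v krylov A B k j = axis (slot j k) 1"
  using V_basis[of "slot j k"] by (simp add: phi_slot)

lemma coord_0: "coord j 0 x = (V *v x) $ slot j (h j - 1)"
  by (simp add: coord_def)

lemma coord_Suc: "coord j (Suc d) x = coord j d (A *v x) - ev (slot j d) * coord j d x"
  by (simp add: coord_def matrix_vector_mult_diff_rdistrib mat_mult_vector vec.diff vec.scale
      flip: matrix_vector_mul_assoc)

lemma coord_add: "coord j d (x + y) = coord j d x + coord j d y"
  by (simp add: coord_def vec.add)

lemma coord_scale: "coord j d (c *s x) = c * coord j d x"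
  by (simp add: coord_def vec.scale)

lemma coord_sum: "coord j d (\<Sum>i\<in>I. f i) = (\<Sum>i\<in>I. coord j d (f i))"
  by (simp add: coord_def vec.sum)

text \<open>
  The coordinate of the last selected vector of column \<open>j\<close> vanishes on all basis vectors that come
  before that vector, and these span the flag up to it.
\<close>

lemma coord_0_flag:
  assumes "k < h j" and x: "x \<in> flag A B j k"
  shows "coord j 0 x = 0"
proof -
  let ?s = "slot j (h j - 1)"
  have "x \<in> vec.span ((\<lambda>(i, l). krylov A B l i) `
          {(i, l) \<in> hermite_positions A B. i < j \<or> i = j \<and> l < k})"
    using x flag_subset_span_selected by blast
  then have "V *v x \<in> {y. y $ ?s = 0}"
  proof (rule mult_span_subset)
    fix s assume "s \<in> (\<lambda>(i, l). krylov A B l i) `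
                        {(i, l) \<in> hermite_positions A B. i < j \<or> i = j \<and> l < k}"
    then obtain i l where s: "s = krylov A B l i" and l: "l < h i" and *: "i < j \<or> i = j \<and> l < k"
      by (auto simp: hermite_positions_def)
    have "\<phi> (slot i l) \<noteq> \<phi> ?s"
      using l * \<open>k < h j\<close> by (auto simp: phi_slot)
    then have "slot i l \<noteq> ?s" by auto
    then show "V *v s \<in> {y. y $ ?s = 0}" by (simp add: s V_krylov[OF l] axis_def)
  qed (simp add: vec.subspace_def)
  then show ?thesis by (simp add: coord_0)
qed

text \<open>
  Each further factor \<open>A - \<mu>\<close> costs one step of the flag, since \<open>A\<close> raises the exponent by one. Together
  with \<open>coord_krylov\<close> this makes \<open>coord j d\<close> dual, up to a triangular matrix, to the selected vector
  with exponent \<open>h j - 1 - d\<close>.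
\<close>

lemma coord_flag: "k + d < h j \<Longrightarrow> x \<in> flag A B j k \<Longrightarrow> coord j d x = 0"
proof (induction d arbitrary: k x)
  case 0
  then show ?case by (simp add: coord_0_flag)
next
  case (Suc d)
  have "coord j d (A *v x) = 0" using Suc by (intro Suc.IH[of "Suc k"]) (auto intro: mult_flag)
  moreover have "coord j d x = 0" using Suc by (intro Suc.IH[of k]) auto
  ultimately show ?case by (simp add: coord_Suc)
qed

text \<open>
  In contrast to \<open>coord_flag\<close> there is no bound on \<open>d\<close>, because \<open>flag A B j 0\<close> is \<open>A\<close>-invariant. In
  particular row \<open>j\<close> of the feedback vanishes on it.
\<close>

lemma coord_flag_0: "0 < h j \<Longrightarrow> x \<in> flag A B j 0 \<Longrightarrow> coord j d x = 0"
proof (induction d arbitrary: x)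
  case 0
  then show ?case by (simp add: coord_0_flag)
next
  case (Suc d)
  then show ?case by (simp add: coord_Suc mult_flag_0)
qed

lemma coord_krylov: "k + d + 1 = h j \<Longrightarrow> coord j d (krylov A B k j) = 1"
proof (induction d arbitrary: k)
  case 0
  then have "k = h j - 1" "k < h j" by auto
  then show ?case by (simp add: coord_0 V_krylov)
next
  case (Suc d)
  have "coord j d (A *v krylov A B k j) = 1" using Suc.IH[of "Suc k"] Suc.prems by (simp add: krylov_Suc)
  moreover have "coord j d (krylov A B k j) = 0"
    using Suc.prems by (intro coord_flag[of "Suc k"]) (auto intro: krylov_in_flag)
  ultimately show ?case by (simp add: coord_Suc)
qed

lemma expansion: "x = (\<Sum>q\<in>UNIV. (V *v x) $ q *s krylov A B (snd (\<phi> q)) (fst (\<phi> q)))"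
proof -
  define T where "T = (\<chi> i q. krylov A B (snd (\<phi> q)) (fst (\<phi> q)) $ i)"
  have column_T: "column q T = krylov A B (snd (\<phi> q)) (fst (\<phi> q))" for q
    by (simp add: column_def T_def)
  have "V ** T = mat 1"
    by (simp add: vec_eq_iff matrix_mult_entry column_T V_basis mat_def axis_def)
  then have "T ** V = mat 1" by (simp add: matrix_left_right_inverse)
  then have "x = T *v (V *v x)" by (simp add: matrix_vector_mul_assoc)
  then show ?thesis by (simp add: matrix_mult_sum column_T)
qed

text \<open>
  Expand \<open>x\<close> in the basis of selected vectors. The last position \<open>(i, l)\<close> with a nonzero coefficient is seen
  by the functional dual to it, since that functional annihilates all earlier basis vectors. This
  shows both that the functionals separate points and how their vanishing confines \<open>x\<close> to the flag.
\<close>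

lemma leading_coord:
  assumes "x \<noteq> 0"
  obtains i l where "l < h i" "x \<in> flag A B i (Suc l)" "coord i (h i - 1 - l) x \<noteq> 0"
proof -
  let ?w = "\<lambda>q. krylov A B (snd (\<phi> q)) (fst (\<phi> q))" and ?pos = "\<lambda>q. lex_pos CARD('n) (\<phi> q)"
  define y where "y = V *v x"
  have x: "x = (\<Sum>q\<in>UNIV. y $ q *s ?w q)" unfolding y_def by (rule expansion)
  define S where "S = {q. y $ q \<noteq> 0}"
  have "S \<noteq> {}"
  proof
    assume "S = {}"
    then have "y $ q = 0" for q by (auto simp: S_def)
    then have "x = 0" by (subst x) simp
    with assms show False ..
  qed
  then have "Max (?pos ` S) \<in> ?pos ` S" by (intro Max_in) auto
  then obtain q where q: "q \<in> S" "?pos q = Max (?pos ` S)" by auto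
  obtain i l where il: "\<phi> q = (i, l)" by force
  have l: "l < h i" using il by (rule phi_less)
  have "y $ p *s ?w p \<in> flag A B i l" if "p \<noteq> q" for p
  proof (cases "p \<in> S")
    case True
    obtain j k where jk: "\<phi> p = (j, k)" by force
    have "k < CARD('n)" "l < CARD('n)"
      using phi_less[OF jk] l hermite_index_le[of A B] by (auto intro: less_le_trans)
    moreover have "?pos p \<le> ?pos q" using True q by simp
    moreover have "(j, k) \<noteq> (i, l)" using that il jk inj_phi by (metis injD)
    ultimately have "j < i \<or> j = i \<and> k < l"
      using lex_pos_less_iff[of l "CARD('n)" k i j] by (auto simp: il jk)
    then show ?thesis
      by (simp add: jk krylov_in_flag vec.subspace_scale subspace_flag)
  next
    case False
    then show ?thesis by (simp add: S_def vec.subspace_0 subspace_flag)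
  qed
  then have rest: "(\<Sum>p\<in>UNIV - {q}. y $ p *s ?w p) \<in> flag A B i l" (is "?r \<in> _")
    by (intro vec.subspace_sum subspace_flag) auto
  have split: "x = y $ q *s krylov A B l i + ?r"
    by (subst x, subst sum.remove[of _ q]) (simp_all add: il)
  show ?thesis
  proof
    show "l < h i" by (rule l)
    show "x \<in> flag A B i (Suc l)"
      using rest flag_mono[of i i l "Suc l" A B]
      by (subst split) (auto intro!: vec.subspace_add vec.subspace_scale subspace_flag krylov_in_flag)
    have "coord i (h i - 1 - l) x = y $ q"
      using l coord_flag[OF _ rest, of "h i - 1 - l"] coord_krylov[of l "h i - 1 - l" i]
      by (subst split) (simp add: coord_add coord_scale)
    then show "coord i (h i - 1 - l) x \<noteq> 0" using q by (simp add: S_def)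
  qed
qed

lemma in_flag_if_coords_vanish:
  assumes "\<And>i d. j < i \<Longrightarrow> d < h i \<Longrightarrow> coord i d x = 0" and "j < j'"
  shows "x \<in> flag A B j' 0"
proof (cases "x = 0")
  case True
  then show ?thesis by (simp add: vec.subspace_0 subspace_flag)
next
  case False
  then obtain i l where il: "l < h i" "x \<in> flag A B i (Suc l)" "coord i (h i - 1 - l) x \<noteq> 0"
    by (rule leading_coord)
  have "\<not> j < i" using il assms(1)[of i "h i - 1 - l"] by auto
  then have "i < j'" using \<open>j < j'\<close> by auto
  with il(2) flag_mono[of i j' "Suc l" 0 A B] show ?thesis by auto
qed

abbreviation K where "K \<equiv> ackermann_feedback h \<phi> ev V A"

lemma feedback_coord: "(K *v x) $ j = (if h j = 0 then 0 else - coord j (h j) x)"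
  by (simp add: ackermann_feedback_def coord_def matrix_vector_mult_nth matrix_vector_mul_assoc sum_negf)

text \<open>
  Triangularity of the closed loop in the dual basis. In \<open>(A + B K) x = A x + \<Sum>\<^sub>i (K x)\<^sub>i b\<^sub>i\<close> the
  terms with \<open>i < j\<close> are annihilated by \<open>coord j d\<close>; those with \<open>i > j\<close> vanish because \<open>x\<close> lies in
  \<open>flag A B i 0\<close>, where row \<open>i\<close> of \<open>K\<close> is zero; and \<open>b\<^sub>j\<close> is seen only by the last functional
  \<open>d = h j - 1\<close>, where the feedback cancels precisely the excess term \<open>coord j (h j) x\<close>.
\<close>

lemma coord_closed_loop:
  assumes "d < h j" and upper: "\<And>i e. j < i \<or> j = i \<and> d < e \<Longrightarrow> e < h i \<Longrightarrow> coord i e x = 0"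
  shows "coord j d ((A + B ** K) *v x) = ev (slot j d) * coord j d x"
proof -
  have pos: "0 < h j" using \<open>d < h j\<close> by simp
  have contrib: "(K *v x) $ i * coord j d (column i B) =
      (if i = j then (if Suc d = h j then - coord j (h j) x else 0) else 0)" for i
  proof (cases i j rule: linorder_cases)
    case less
    then have "coord j d (krylov A B 0 i) = 0"
      using pos by (intro coord_flag_0 krylov_in_flag) auto
    with less show ?thesis by (simp add: krylov_0)
  next
    case equal
    show ?thesis
    proof (cases "Suc d = h j")
      case True
      then have "coord j d (krylov A B 0 j) = 1" by (intro coord_krylov) simp
      then show ?thesis using True equal pos by (simp add: krylov_0 feedback_coord)
    next
      case False
      then have "coord j d (krylov A B 0 j) = 0"
        using \<open>d < h j\<close> by (intro coord_flag[of "Suc 0"] krylov_in_flag) auto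
      then show ?thesis using False equal by (simp add: krylov_0)
    qed
  next
    case greater
    then have "x \<in> flag A B i 0" using upper by (intro in_flag_if_coords_vanish) auto
    then have "(K *v x) $ i = 0" by (simp add: feedback_coord coord_flag_0)
    with greater show ?thesis by simp
  qed
  have "(A + B ** K) *v x = A *v x + (\<Sum>i\<in>UNIV. (K *v x) $ i *s column i B)"
    by (simp add: matrix_vector_mult_add_rdistrib matrix_mult_sum[of B] flip: matrix_vector_mul_assoc)
  then have "coord j d ((A + B ** K) *v x) =
      coord j d (A *v x) + (if Suc d = h j then - coord j (h j) x else 0)"
    by (simp add: coord_add coord_sum coord_scale contrib)
  also have "coord j d (A *v x) = coord j (Suc d) x + ev (slot j d) * coord j d x"
    by (simp add: coord_Suc)
  also have "coord j (Suc d) x + ev (slot j d) * coord j d x + (if Suc d = h j then - coord j (h j) x else 0)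
      = ev (slot j d) * coord j d x"
    using upper[of j "Suc d"] \<open>d < h j\<close> by (cases "Suc d = h j") auto
  finally show ?thesis .
qed

proposition det_closed_loop: "det (mat z - (A + B ** K)) = (\<Prod>i\<in>UNIV. z - ev i)"
proof -
  define W :: "complex^'n^'n" where
    "W = (\<chi> q. (V ** shift_prod A (\<lambda>d. ev (slot (fst (\<phi> q)) d)) (snd (\<phi> q)))
              $ slot (fst (\<phi> q)) (h (fst (\<phi> q)) - 1))"
  have W: "(W *v x) $ q = coord (fst (\<phi> q)) (snd (\<phi> q)) x" for q x
    by (simp add: W_def coord_def matrix_vector_mult_nth matrix_vector_mul_assoc)
  have W_slot: "(W *v x) $ slot j d = coord j d x" if "d < h j" for j d x
    by (simp add: W phi_slot that)
  \<comment> \<open>The rows of \<open>W\<close> are all the functionals \<open>coord j d\<close>; no nonzero vector is killed by all of them.\<close>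
  have "x = 0" if "W *v x = 0" for x
  proof (rule ccontr)
    assume "x \<noteq> 0"
    then obtain i l where "l < h i" "coord i (h i - 1 - l) x \<noteq> 0" by (rule leading_coord)
    then have "(W *v x) $ slot i (h i - 1 - l) \<noteq> 0" by (subst W_slot) auto
    with that show False by simp
  qed
  then have "invertible W"
    by (simp add: invertible_left_inverse matrix_left_invertible_ker)
  moreover have "inj (\<lambda>q. lex_pos CARD('n) (\<phi> q))"
  proof -
    have "range \<phi> \<subseteq> {(j, k). k < CARD('n)}"
    proof clarify
      fix j k q assume "(j, k) = \<phi> q"
      then show "k < CARD('n)"
        using phi_less[of q j k] hermite_index_le[of A B j] by simp
    qed
    then show ?thesis
      using comp_inj_on[OF inj_phi inj_on_subset[OF inj_on_lex_pos]] by (simp add: o_def)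
  qed
  moreover have "(W *v ((A + B ** K) *v x)) $ q = ev q * (W *v x) $ q"
    if *: "\<And>p. lex_pos CARD('n) (\<phi> q) < lex_pos CARD('n) (\<phi> p) \<Longrightarrow> (W *v x) $ p = 0" for q x
  proof -
    obtain j d where jd: "\<phi> q = (j, d)" by force
    have d: "d < h j" using jd by (rule phi_less)
    have "coord i e x = 0" if "j < i \<or> j = i \<and> d < e" and e: "e < h i" for i e
    proof -
      have "d < CARD('n)" using d hermite_index_le[of A B j] by simp
      then have "lex_pos CARD('n) (\<phi> q) < lex_pos CARD('n) (\<phi> (slot i e))"
        using that by (simp add: jd phi_slot lex_pos_less)
      then show ?thesis using * W_slot[OF e] by metis
    qed
    from coord_closed_loop[OF d this] show ?thesis
      by (simp add: W jd slot_eq[OF jd])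
  qed
  ultimately show ?thesis by (rule det_char_of_triangular_rows)
qed

end

section \<open>Spectrum of a multiplication operator\<close>

lemma bounded_operator_mult_operator:
  fixes N :: "complex \<Rightarrow> complex^'n^'n"
  assumes "P \<noteq> {}" and "compact P" and N: "continuous_on P N"
  shows "bounded_operator P (mult_operator N)"
proof -
  define c where "c t = (\<Sum>i\<in>UNIV. \<Sum>j\<in>UNIV. norm (N t $ i $ j))" for t
  \<comment> \<open>The sum of the absolute values of the entries is a crude but continuous bound on the operator norm.\<close>
  have opnorm: "norm (N t *v x) \<le> c t * norm x" for t x
  proof -
    have "norm (N t *v x) \<le> (\<Sum>i\<in>UNIV. norm ((N t *v x) $ i))"
      unfolding norm_vec_def by (rule L2_set_le_sum) simp
    also have "\<dots> \<le> (\<Sum>i\<in>UNIV. \<Sum>j\<in>UNIV. norm (N t $ i $ j) * norm x)"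
      unfolding matrix_vector_mult_nth
      by (intro sum_mono sum_norm_le) (simp add: norm_mult mult_left_mono Finite_Cartesian_Product.norm_nth_le)
    finally show ?thesis by (simp add: c_def sum_distrib_right)
  qed
  have "continuous_on P c"
    unfolding c_def by (intro continuous_on_sum continuous_on_norm continuous_on_component N)
  then have "bounded (c ` P)"
    by (intro compact_imp_bounded compact_continuous_image \<open>compact P\<close>)
  then obtain C where C: "\<And>t. t \<in> P \<Longrightarrow> c t \<le> C"
    unfolding bounded_iff by (auto dest: order.trans[OF abs_ge_self])
  have "0 \<le> c t" for t by (simp add: c_def sum_nonneg)
  with C \<open>P \<noteq> {}\<close> have "0 \<le> C" by (meson all_not_in_conv order.trans)
  have "sup_norm P (mult_operator N f) \<le> C * sup_norm P f" if "f \<in> cont_space P" for f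
    unfolding sup_norm_def[of P "mult_operator N f"]
  proof (rule cSUP_least[OF \<open>P \<noteq> {}\<close>])
    fix t assume t: "t \<in> P"
    have "bounded ((\<lambda>t. norm (f t)) ` P)"
      using that by (intro compact_imp_bounded compact_continuous_image \<open>compact P\<close> continuous_on_norm)
        (simp add: cont_space_def)
    then have "norm (f t) \<le> sup_norm P f"
      unfolding sup_norm_def by (intro cSUP_upper t bounded_imp_bdd_above)
    moreover have "norm (N t *v f t) \<le> C * norm (f t)"
      by (rule order.trans[OF opnorm mult_right_mono[OF C[OF t] norm_ge_zero]])
    ultimately show "norm (mult_operator N f t) \<le> C * sup_norm P f"
      using \<open>0 \<le> C\<close> unfolding mult_operator_def by (meson mult_left_mono order.trans)
  qed
  then show ?thesis
    unfolding bounded_operator_def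
    by (auto simp: mult_operator_def cont_space_def vec.add vec.scale
        intro!: continuous_on_matrix_vector_mult N)
qed

text \<open>
  If \<open>z I - M \<theta>\<close> is singular for some parameter \<open>\<theta>\<close>, a vector outside its range, taken as a constant
  function, is not in the range of the operator. Otherwise the pointwise inverse is continuous, and
  multiplication by it is a bounded inverse.
\<close>

proposition op_spectrum_mult_operator:
  fixes M :: "complex \<Rightarrow> complex^'n^'n"
  assumes "P \<noteq> {}" and "compact P" and M: "continuous_on P M"
  shows "op_spectrum P (mult_operator M) = {z. \<exists>\<theta>\<in>P. det (mat z - M \<theta>) = 0}"
proof (intro set_eqI iffI)
  fix z assume "z \<in> {z. \<exists>\<theta>\<in>P. det (mat z - M \<theta>) = 0}"
  then obtain \<theta> where \<theta>: "\<theta> \<in> P" "\<not> invertible (mat z - M \<theta>)"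
    by (auto simp: invertible_det_nz)
  then obtain v where v: "v \<notin> range ((*v) (mat z - M \<theta>))"
    by (auto simp: invertible_right_inverse matrix_right_invertible_surjective)
  define f where "f t = (if t \<in> P then v else 0)" for t
  have "continuous_on P f \<longleftrightarrow> continuous_on P (\<lambda>_. v)"
    by (rule continuous_on_cong) (auto simp: f_def)
  then have f: "f \<in> cont_space P" by (simp add: cont_space_def f_def)
  show "z \<in> op_spectrum P (mult_operator M)"
  proof (rule ccontr)
    assume "z \<notin> op_spectrum P (mult_operator M)"
    then obtain S where "\<forall>f\<in>cont_space P. (\<lambda>t. z *s S f t - mult_operator M (S f) t) = f"
      unfolding op_spectrum_def by blast
    with f have "(\<lambda>t. z *s S f t - mult_operator M (S f) t) = f" by blast
    from fun_cong[OF this, of \<theta>] have "(mat z - M \<theta>) *v S f \<theta> = v"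
      using \<theta> by (simp add: mult_operator_def f_def matrix_vector_mult_diff_rdistrib mat_mult_vector)
    with v show False by blast
  qed
next
  fix z assume z: "z \<in> op_spectrum P (mult_operator M)"
  show "z \<in> {z. \<exists>\<theta>\<in>P. det (mat z - M \<theta>) = 0}"
  proof (rule ccontr)
    assume "z \<notin> {z. \<exists>\<theta>\<in>P. det (mat z - M \<theta>) = 0}"
    then have nonsingular: "invertible (mat z - M t)" if "t \<in> P" for t
      using that by (auto simp: invertible_det_nz)
    have "continuous_on P (\<lambda>t. mat z - M t)"
      by (intro continuous_on_diff continuous_on_const M)
    from continuous_inverse_matrix[OF this nonsingular] obtain N where N: "continuous_on P N"
      "\<forall>t\<in>P. (mat z - M t) ** N t = mat 1 \<and> N t ** (mat z - M t) = mat 1"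
      by blast
    have shift: "z *s x - M t *v x = (mat z - M t) *v x" for t x
      by (simp add: matrix_vector_mult_diff_rdistrib mat_mult_vector)
    have cancel: "(mat z - M t) *v (N t *v x) = x \<and> N t *v ((mat z - M t) *v x) = x" if "t \<in> P" for t x
      using N(2) that by (simp add: matrix_vector_mul_assoc)
    have "z *s mult_operator N f t - mult_operator M (mult_operator N f) t = f t \<and>
          mult_operator N (\<lambda>t. z *s f t - mult_operator M f t) t = f t"
      if "f \<in> cont_space P" for f t
      using that by (cases "t \<in> P") (simp_all add: mult_operator_def shift cancel cont_space_def)
    then have "z \<notin> op_spectrum P (mult_operator M)"
      using bounded_operator_mult_operator[OF assms(1,2) N(1)]
      unfolding op_spectrum_def by blast
    with z show False by simp
  qed
qed

section \<open>Continuous pole placement\<close>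

lemma continuous_on_krylov:
  assumes "continuous_on P A" and "continuous_on P B"
  shows "continuous_on P (\<lambda>t. krylov (A t) (B t) k j)"
proof (induction k)
  case 0
  show ?case unfolding krylov_0 column_def
    by (intro continuous_on_vec_lambda continuous_on_component assms)
next
  case (Suc k)
  then show ?case unfolding krylov_Suc by (intro continuous_on_matrix_vector_mult assms)
qed

lemma continuous_on_shift_prod:
  fixes A :: "'b::topological_space \<Rightarrow> complex^'k^'k"
  assumes "continuous_on P A" and "\<And>d. continuous_on P (\<lambda>t. \<mu> t d)"
  shows "continuous_on P (\<lambda>t. shift_prod (A t) (\<mu> t) d)"
proof (induction d)
  case 0
  show ?case by simp
next
  case (Suc d)
  have "continuous_on P (\<lambda>t. if i = j then \<mu> t d else 0)" for i j :: 'k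
    by (cases "i = j") (simp_all add: assms)
  then have "continuous_on P (\<lambda>t. mat (\<mu> t d) :: complex^'k^'k)"
    unfolding mat_def by (intro continuous_on_vec_lambda)
  then show ?case
    unfolding shift_prod.simps by (intro continuous_on_matrix_mult continuous_on_diff Suc assms)
qed

lemma continuous_on_ackermann_feedback:
  assumes "continuous_on P A" and "continuous_on P V" and "\<And>i. continuous_on P (ev i)"
  shows "continuous_on P (\<lambda>t. ackermann_feedback h \<phi> (\<lambda>i. ev i t) (V t) (A t))"
  unfolding ackermann_feedback_def
proof (rule continuous_on_vec_lambda)
  fix j
  show "continuous_on P (\<lambda>t. if h j = 0 then 0
     else - (V t ** shift_prod (A t) (\<lambda>d. ev (inv \<phi> (j, d)) t) (h j)) $ inv \<phi> (j, h j - 1))"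
    by (cases "h j = 0")
      (simp_all add: continuous_on_minus continuous_on_component continuous_on_matrix_mult
        continuous_on_shift_prod assms)
qed

theorem theorem3p9:
  fixes P :: "complex set"
    and A :: "complex \<Rightarrow> complex^'n::{finite,linorder}^'n::{finite,linorder}"
    and B :: "complex \<Rightarrow> complex^'m::{finite,linorder}^'n::{finite,linorder}"
    and ev :: "'n::{finite,linorder} \<Rightarrow> complex \<Rightarrow> complex"
  assumes "P \<noteq> {}" and "compact P"
    and "continuous_on P A" and "continuous_on P B"
    and "\<And>\<theta>. \<theta> \<in> P \<Longrightarrow> reachable (A \<theta>) (B \<theta>)"
    and "\<And>\<theta> \<theta>' j. \<theta> \<in> P \<Longrightarrow> \<theta>' \<in> P \<Longrightarrow>
           hermite_index (A \<theta>) (B \<theta>) j = hermite_index (A \<theta>') (B \<theta>') j"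
    and "\<And>i. continuous_on P (ev i)"
  shows "\<exists>K :: complex \<Rightarrow> complex^'n::{finite,linorder}^'m::{finite,linorder}. continuous_on P K \<and>
           op_spectrum P (mult_operator (\<lambda>\<theta>. A \<theta> + B \<theta> ** K \<theta>)) = (\<Union>\<theta>\<in>P. {ev i \<theta> | i. True})"
proof -
  obtain \<theta>\<^sub>0 where \<theta>\<^sub>0: "\<theta>\<^sub>0 \<in> P" using \<open>P \<noteq> {}\<close> by blast
  define h where "h = hermite_index (A \<theta>\<^sub>0) (B \<theta>\<^sub>0)"
  define H where "H = hermite_positions (A \<theta>\<^sub>0) (B \<theta>\<^sub>0)"
  \<comment> \<open>Constancy of the indices lets one bijection \<open>\<phi>\<close> number the selected vectors for all parameters.\<close>
  have h: "hermite_index (A \<theta>) (B \<theta>) = h" if "\<theta> \<in> P" for \<theta>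
    unfolding h_def using assms(6)[OF that \<theta>\<^sub>0] by blast
  have H: "hermite_positions (A \<theta>) (B \<theta>) = H" if "\<theta> \<in> P" for \<theta>
    unfolding H_def hermite_positions_def by (simp add: h that \<theta>\<^sub>0)
  have "card H = CARD('n)" using hermite_basis(1)[OF assms(5)[OF \<theta>\<^sub>0]] by (simp add: H_def)
  moreover have "finite H" by (simp add: H_def hermite_positions_def)
  ultimately obtain \<phi> :: "'n \<Rightarrow> 'm \<times> nat" where \<phi>: "bij_betw \<phi> UNIV H"
    using finite_same_card_bij[of "UNIV :: 'n set" H] by auto
  define T :: "complex \<Rightarrow> complex^'n::{finite,linorder}^'n::{finite,linorder}" where
    "T \<theta> = (\<chi> i q. krylov (A \<theta>) (B \<theta>) (snd (\<phi> q)) (fst (\<phi> q)) $ i)" for \<theta>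
  have column_T: "column q (T \<theta>) = krylov (A \<theta>) (B \<theta>) (snd (\<phi> q)) (fst (\<phi> q))" for q \<theta>
    by (simp add: column_def T_def)
  have "continuous_on P T"
    unfolding T_def
    by (intro continuous_on_vec_lambda continuous_on_component continuous_on_krylov assms)
  moreover have "invertible (T \<theta>)" if "\<theta> \<in> P" for \<theta>
  proof -
    have "columns (T \<theta>) = (\<lambda>(i, l). krylov (A \<theta>) (B \<theta>) l i) ` range \<phi>"
      by (auto simp: columns_def column_T case_prod_unfold)
    also have "range \<phi> = hermite_positions (A \<theta>) (B \<theta>)"
      using \<phi> H[OF that] by (simp add: bij_betw_def)
    finally show ?thesis
      using hermite_basis(2)[OF assms(5)[OF that]]
      by (simp add: invertible_right_inverse matrix_right_invertible_span_columns)
  qed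
  ultimately have "\<exists>V. continuous_on P V \<and> (\<forall>\<theta>\<in>P. T \<theta> ** V \<theta> = mat 1 \<and> V \<theta> ** T \<theta> = mat 1)"
    by (rule continuous_inverse_matrix)
  then obtain V where V: "continuous_on P V" "\<forall>\<theta>\<in>P. V \<theta> ** T \<theta> = mat 1" by blast
  define K :: "complex \<Rightarrow> complex^'n::{finite,linorder}^'m::{finite,linorder}" where
    "K \<theta> = ackermann_feedback h \<phi> (\<lambda>i. ev i \<theta>) (V \<theta>) (A \<theta>)" for \<theta>
  have K: "continuous_on P K"
    unfolding K_def by (intro continuous_on_ackermann_feedback assms V)
  have det: "det (mat z - (A \<theta> + B \<theta> ** K \<theta>)) = (\<Prod>i\<in>UNIV. z - ev i \<theta>)" if "\<theta> \<in> P" for z \<theta>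
  proof -
    interpret hermite_coordinates "A \<theta>" "B \<theta>" \<phi> "V \<theta>" "\<lambda>i. ev i \<theta>"
    proof
      show "bij_betw \<phi> UNIV (hermite_positions (A \<theta>) (B \<theta>))" using \<phi> H[OF that] by simp
      show "V \<theta> *v krylov (A \<theta>) (B \<theta>) (snd (\<phi> q)) (fst (\<phi> q)) = axis q 1" for q
        using V(2) that
        by (simp add: vec_eq_iff matrix_mult_entry column_T mat_def axis_def)
    qed
    show ?thesis using det_closed_loop[of z] by (simp add: K_def h[OF that])
  qed
  have "continuous_on P (\<lambda>\<theta>. A \<theta> + B \<theta> ** K \<theta>)"
    by (intro continuous_on_add continuous_on_matrix_mult K assms)
  then have "op_spectrum P (mult_operator (\<lambda>\<theta>. A \<theta> + B \<theta> ** K \<theta>)) =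
      {z. \<exists>\<theta>\<in>P. (\<Prod>i\<in>UNIV. z - ev i \<theta>) = 0}"
    using assms(1,2) by (simp add: op_spectrum_mult_operator det)
  also have "\<dots> = (\<Union>\<theta>\<in>P. {ev i \<theta> | i. True})" by (auto simp: prod_zero_iff)
  finally show ?thesis using K by blast
qed

end
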